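(* Let $(\mathscr{G},\sigma)$ be a braided dynamical group over $\Lambda$, with $\mathscr{G}=(G,\Lambda,\phi_G)$ and $\sigma(\lambda,a,b)=(a\rightharpoonup_\lambda b,\ a\leftharpoonup_\lambda b)$. Let $Q(\mathscr{G})=\Lambda\times G$ be the associated groupoid over $\Lambda$, with source $\alpha(\lambda,a)=\lambda$, target $\beta(\lambda,a)=\phi_G(\lambda,a)$ and multiplication $(\lambda,a)\star(\phi_G(\lambda,a),b)=(\lambda,a\circ_\lambda b)$. Then $(Q(\mathscr{G}),\hat\sigma)$ is a braided groupoid, where $\hat\sigma:Q(\mathscr{G})_\beta\times_\alpha Q(\mathscr{G})\to Q(\mathscr{G})_\beta\times_\alpha Q(\mathscr{G})$ is given by $$\hat\sigma\big((\lambda,a),(\lambda',b)\big)=\big((\lambda,a\rightharpoonup_\lambda b),\ (\phi_G(\lambda,a\rightharpoonup_\lambda b),a\leftharpoonup_\lambda b)\big)$$ for all $(\lambda,a),(\lambda',b)\in Q(\mathscr{G})$ with $\lambda'=\phi_G(\lambda,a)$.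
   Context: Fix a non-empty set $\Lambda$. A dynamical set is a triple $\mathscr{X}=(X,\Lambda,\phi_X)$ with $X$ a set and $\phi_X:\Lambda\times X\to\Lambda$ a map. A morphism $\mathscr{X}\to\mathscr{Y}$ is a map $f:\Lambda\times X\to Y$ with $\phi_Y(\lambda,f(\lambda,x))=\phi_X(\lambda,x)$. The tensor product is $\mathscr{X}\otimes\mathscr{Y}=(X\times Y,\Lambda,\phi_{X\times Y})$, $\phi_{X\times Y}(\lambda,x,y)=\phi_Y(\phi_X(\lambda,x),y)$. Dynamical group: a dynamical set $\mathscr{G}=(G,\Lambda,\phi_G)$ with maps $\circ_\lambda:G\times G\to G$ ($\lambda\in\Lambda$) such that $\phi_G(\lambda,a\circ_\lambda b)=\phi_G(\phi_G(\lambda,a),b)$ and $a\circ_\lambda(b\circ_{\phi_G(\lambda,a)}c)=(a\circ_\lambda b)\circ_\lambda c$; an element $e_G\in G$ with $a\circ_\lambda e_G=e_G\circ_\lambda a=a$ and $\phi_G(\lambda,e_G)=\lambda$; and for all $\lambda,a$ an element $\bar a^\lambda\in G$ with $a\circ_\lambda\bar a^\lambda=\bar a^\lambda\circ_{\phi_G(\lambda,a)}a=e_G$. Then $Q(\mathscr{G})$ as in the claim is a groupoid with units $(\lambda,e_G)$ and inverses $(\phi_G(\lambda,a),\bar a^\lambda)$ of $(\lambda,a)$. Matched pair of dynamical groups $(\mathscr{G},\mathscr{H},\sigma)$: dynamical groups $(\mathscr{G},\circ)$, $(\mathscr{H},\cdot)$ and a map $\sigma:\Lambda\times G\times H\to H\times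 G$, written $\sigma(\lambda,a,x)=(a\rightharpoonup_\lambda x,\ a\leftharpoonup_\lambda x)$ (the subscript is the first argument of $\sigma$), which is a morphism $\mathscr{G}\otimes\mathscr{H}\to\mathscr{H}\otimes\mathscr{G}$, i.e. $\phi_G(\phi_H(\lambda,a\rightharpoonup_\lambda x),a\leftharpoonup_\lambda x)=\phi_H(\phi_G(\lambda,a),x)$, such that for all $\lambda\in\Lambda$, $a,b\in G$, $x,y\in H$: (1) $e_G\rightharpoonup_\lambda x=x$; (2) $(a\circ_\lambda b)\rightharpoonup_\lambda x=a\rightharpoonup_\lambda(b\rightharpoonup_{\phi_G(\lambda,a)}x)$; (3) $a\rightharpoonup_\lambda(x\cdot_{\phi_G(\lambda,a)}y)=(a\rightharpoonup_\lambda x)\cdot_\lambda\big((a\leftharpoonup_\lambda x)\rightharpoonup_{\phi_H(\lambda,a\rightharpoonup_\lambda x)}y\big)$; (4) $a\leftharpoonup_\lambda e_H=a$; (5) $a\leftharpoonup_\lambda(x\cdot_{\phi_G(\lambda,a)}y)=(a\leftharpoonup_\lambda x)\leftharpoonup_{\phi_H(\lambda,a\rightharpoonup_\lambda x)}y$; (6) $(a\circ_\lambda b)\leftharpoonup_\lambda x=\big(a\leftharpoonup_\lambda(b\rightharpoonup_{\phi_G(\lambda,a)}x)\big)\circ_{\phi_H(\lambda,(a\circ_\lambda b)\rightharpoonup_\lambda x)}(b\leftharpoonup_{\phi_G(\lambda,a)}x)$. Braided dynamical group $(\mathscr{G},\sigma)$: a dynamical group $(\mathscr{G},\circ)$ with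 $\sigma:\Lambda\times G\times G\to G\times G$ such that $(\mathscr{G},\mathscr{G},\sigma)$ is a matched pair of dynamical groups and $(a\rightharpoonup_\lambda b)\circ_\lambda(a\leftharpoonup_\lambda b)=a\circ_\lambda b$ for all $\lambda,a,b$. Matched pair of groupoids $(\mathbb{G},\mathbb{H},\sigma)$: groupoids $\mathbb{G}$ (source $\alpha$, target $\beta$) and $\mathbb{H}$ (source $s$, target $t$) over the same base (products $\gamma_1\star\gamma_2$ defined when the target of $\gamma_1$ is the source of $\gamma_2$, identities $\iota_m$) and a map $\sigma:\mathbb{G}_\beta\times_s\mathbb{H}\to\mathbb{H}_t\times_\alpha\mathbb{G}$, $(\gamma,\delta)\mapsto(\gamma\rightharpoonup\delta,\gamma\leftharpoonup\delta)$, where $\mathbb{G}_\beta\times_s\mathbb{H}=\{(\gamma,\delta):\beta(\gamma)=s(\delta)\}$, that is a homomorphism of quivers ($s(\gamma\rightharpoonup\delta)=\alpha(\gamma)$, $\beta(\gamma\leftharpoonup\delta)=t(\delta)$), such that, whenever defined: $\iota_{s(\delta)}\rightharpoonup\delta=\delta$; $\gamma_1\rightharpoonup(\gamma_2\rightharpoonup\delta)=(\gamma_1\star\gamma_2)\rightharpoonup\delta$; $(\gamma_1\star\gamma_2)\leftharpoonup\delta=(\gamma_1\leftharpoonup(\gamma_2\rightharpoonup\delta))\star(\gamma_2\leftharpoonup\delta)$; $\gamma\leftharpoonup\iota_{\beta(\gamma)}=\gamma$; $(\gamma\leftharpoonup\delta_1)\leftharpoonup\delta_2=\gamma\leftharpoonup(\delta_1\star\delta_2)$;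 $\gamma\rightharpoonup(\delta_1\star\delta_2)=(\gamma\rightharpoonup\delta_1)\star((\gamma\leftharpoonup\delta_1)\rightharpoonup\delta_2)$. Braided groupoid $(\mathbb{G},\sigma)$: a groupoid $\mathbb{G}$ with $\sigma:\mathbb{G}_\beta\times_\alpha\mathbb{G}\to\mathbb{G}_\beta\times_\alpha\mathbb{G}$ such that $(\mathbb{G},\mathbb{G},\sigma)$ is a matched pair of groupoids and $(\gamma\rightharpoonup\delta)\star(\gamma\leftharpoonup\delta)=\gamma\star\delta$ for all composable $(\gamma,\delta)$. *)

theory Defs
  imports "HOL-Library.FuncSet"
begin

record ('l, 'x) dyn_set =
  elems :: "'x set"
  params :: "'l set"
  act :: "'l \<times> 'x \<Rightarrow> 'l"

locale dynamical_set =
  fixes X :: "('l, 'x, 'z) dyn_set_scheme"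
  assumes params_nonempty: "params X \<noteq> {}"
    and act_closed: "act X \<in> params X \<times> elems X \<rightarrow> params X"

definition dyn_morphism ::
  "('l, 'x, 'z) dyn_set_scheme \<Rightarrow> ('l, 'y, 'w) dyn_set_scheme \<Rightarrow> ('l \<times> 'x \<Rightarrow> 'y) \<Rightarrow> bool" where
  "dyn_morphism X Y f \<longleftrightarrow>
     params X = params Y \<and>
     f \<in> params X \<times> elems X \<rightarrow> elems Y \<and>
     (\<forall>l\<in>params X. \<forall>x\<in>elems X. act Y (l, f (l, x)) = act X (l, x))"

text \<open>The tensor product is only meant for two dynamical sets with the same parameter set.\<close>

definition dyn_tensor ::
  "('l, 'x, 'z) dyn_set_scheme \<Rightarrow> ('l, 'y, 'w) dyn_set_scheme \<Rightarrow> ('l, 'x \<times> 'y) dyn_set" where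
  "dyn_tensor X Y =
     \<lparr>elems = elems X \<times> elems Y, params = params X,
      act = (\<lambda>(l, x, y). act Y (act X (l, x), y))\<rparr>"

record ('l, 'g) dyn_group = "('l, 'g) dyn_set" +
  op :: "'l \<Rightarrow> 'g \<Rightarrow> 'g \<Rightarrow> 'g"
  neutral :: 'g

locale dynamical_group = dynamical_set G
  for G :: "('l, 'g, 'z) dyn_group_scheme" +
  assumes op_closed:
      "\<lbrakk>l \<in> params G; a \<in> elems G; b \<in> elems G\<rbrakk> \<Longrightarrow> op G l a b \<in> elems G"
    and act_op:
      "\<lbrakk>l \<in> params G; a \<in> elems G; b \<in> elems G\<rbrakk>
        \<Longrightarrow> act G (l, op G l a b) = act G (act G (l, a), b)"
    and op_assoc:
      "\<lbrakk>l \<in> params G; a \<in> elems G; b \<in> elems G; c \<in> elems G\<rbrakk>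
        \<Longrightarrow> op G l a (op G (act G (l, a)) b c) = op G l (op G l a b) c"
    and neutral_closed: "neutral G \<in> elems G"
    and op_neutral:
      "\<lbrakk>l \<in> params G; a \<in> elems G\<rbrakk> \<Longrightarrow> op G l a (neutral G) = a"
    and neutral_op:
      "\<lbrakk>l \<in> params G; a \<in> elems G\<rbrakk> \<Longrightarrow> op G l (neutral G) a = a"
    and act_neutral: "l \<in> params G \<Longrightarrow> act G (l, neutral G) = l"
    and inverse_exists:
      "\<lbrakk>l \<in> params G; a \<in> elems G\<rbrakk>
        \<Longrightarrow> \<exists>b\<in>elems G. op G l a b = neutral G \<and> op G (act G (l, a)) b a = neutral G"

locale dyn_pair =
  fixes G :: "('l, 'g, 'z) dyn_group_scheme"
    and H :: "('l, 'h, 'w) dyn_group_scheme"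
    and \<sigma> :: "'l \<times> 'g \<times> 'h \<Rightarrow> 'h \<times> 'g"
begin

abbreviation opG (\<open>(_ \<circ>\<^bsub>_\<^esub> _)\<close> [71, 0, 71] 70) where
  "a \<circ>\<^bsub>l\<^esub> b \<equiv> op G l a b"

abbreviation opH (\<open>(_ \<cdot>\<^bsub>_\<^esub> _)\<close> [71, 0, 71] 70) where
  "x \<cdot>\<^bsub>l\<^esub> y \<equiv> op H l x y"

abbreviation lact (\<open>(_ \<rightharpoonup>\<^bsub>_\<^esub> _)\<close> [71, 0, 71] 70) where
  "a \<rightharpoonup>\<^bsub>l\<^esub> x \<equiv> fst (\<sigma> (l, a, x))"

abbreviation ract (\<open>(_ \<leftharpoonup>\<^bsub>_\<^esub> _)\<close> [71, 0, 71] 70) where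
  "a \<leftharpoonup>\<^bsub>l\<^esub> x \<equiv> snd (\<sigma> (l, a, x))"

end

locale matched_pair_dynamical_groups =
  dyn_pair G H \<sigma> + G: dynamical_group G + H: dynamical_group H
  for G :: "('l, 'g, 'z) dyn_group_scheme"
    and H :: "('l, 'h, 'w) dyn_group_scheme"
    and \<sigma> :: "'l \<times> 'g \<times> 'h \<Rightarrow> 'h \<times> 'g" +
  assumes same_params: "params G = params H"
    and morphism: "dyn_morphism (dyn_tensor G H) (dyn_tensor H G) \<sigma>"
    and neutral_lact:
      "\<lbrakk>l \<in> params G; x \<in> elems H\<rbrakk> \<Longrightarrow> neutral G \<rightharpoonup>\<^bsub>l\<^esub> x = x"
    and op_lact:
      "\<lbrakk>l \<in> params G; a \<in> elems G; b \<in> elems G; x \<in> elems H\<rbrakk>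
        \<Longrightarrow> (a \<circ>\<^bsub>l\<^esub> b) \<rightharpoonup>\<^bsub>l\<^esub> x = a \<rightharpoonup>\<^bsub>l\<^esub> (b \<rightharpoonup>\<^bsub>act G (l, a)\<^esub> x)"
    and lact_op:
      "\<lbrakk>l \<in> params G; a \<in> elems G; x \<in> elems H; y \<in> elems H\<rbrakk>
        \<Longrightarrow> a \<rightharpoonup>\<^bsub>l\<^esub> (x \<cdot>\<^bsub>act G (l, a)\<^esub> y)
            = (a \<rightharpoonup>\<^bsub>l\<^esub> x) \<cdot>\<^bsub>l\<^esub> ((a \<leftharpoonup>\<^bsub>l\<^esub> x) \<rightharpoonup>\<^bsub>act H (l, a \<rightharpoonup>\<^bsub>l\<^esub> x)\<^esub> y)"
    and ract_neutral:
      "\<lbrakk>l \<in> params G; a \<in> elems G\<rbrakk> \<Longrightarrow> a \<leftharpoonup>\<^bsub>l\<^esub> neutral H = a"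
    and ract_op:
      "\<lbrakk>l \<in> params G; a \<in> elems G; x \<in> elems H; y \<in> elems H\<rbrakk>
        \<Longrightarrow> a \<leftharpoonup>\<^bsub>l\<^esub> (x \<cdot>\<^bsub>act G (l, a)\<^esub> y)
            = (a \<leftharpoonup>\<^bsub>l\<^esub> x) \<leftharpoonup>\<^bsub>act H (l, a \<rightharpoonup>\<^bsub>l\<^esub> x)\<^esub> y"
    and op_ract:
      "\<lbrakk>l \<in> params G; a \<in> elems G; b \<in> elems G; x \<in> elems H\<rbrakk>
        \<Longrightarrow> (a \<circ>\<^bsub>l\<^esub> b) \<leftharpoonup>\<^bsub>l\<^esub> x
            = (a \<leftharpoonup>\<^bsub>l\<^esub> (b \<rightharpoonup>\<^bsub>act G (l, a)\<^esub> x))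
                \<circ>\<^bsub>act H (l, (a \<circ>\<^bsub>l\<^esub> b) \<rightharpoonup>\<^bsub>l\<^esub> x)\<^esub> (b \<leftharpoonup>\<^bsub>act G (l, a)\<^esub> x)"

locale braided_dynamical_group = matched_pair_dynamical_groups G G \<sigma>
  for G :: "('l, 'g, 'z) dyn_group_scheme"
    and \<sigma> :: "'l \<times> 'g \<times> 'g \<Rightarrow> 'g \<times> 'g" +
  assumes braided_commutative:
    "\<lbrakk>l \<in> params G; a \<in> elems G; b \<in> elems G\<rbrakk>
      \<Longrightarrow> (a \<rightharpoonup>\<^bsub>l\<^esub> b) \<circ>\<^bsub>l\<^esub> (a \<leftharpoonup>\<^bsub>l\<^esub> b) = a \<circ>\<^bsub>l\<^esub> b"

text \<open>
  The product is a total function; only its values on pairs \<open>(g, h)\<close> of arrows with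
  \<open>tgt g = src h\<close> are meaningful.
\<close>

record ('m, 'a) grpd =
  base :: "'m set"
  arrows :: "'a set"
  src :: "'a \<Rightarrow> 'm"
  tgt :: "'a \<Rightarrow> 'm"
  comp :: "'a \<Rightarrow> 'a \<Rightarrow> 'a"
  ident :: "'m \<Rightarrow> 'a"

locale groupoid =
  fixes G :: "('m, 'a, 'z) grpd_scheme"
  assumes src_closed: "src G \<in> arrows G \<rightarrow> base G"
    and tgt_closed: "tgt G \<in> arrows G \<rightarrow> base G"
    and comp_closed:
      "\<lbrakk>g \<in> arrows G; h \<in> arrows G; tgt G g = src G h\<rbrakk> \<Longrightarrow> comp G g h \<in> arrows G"
    and src_comp:
      "\<lbrakk>g \<in> arrows G; h \<in> arrows G; tgt G g = src G h\<rbrakk> \<Longrightarrow> src G (comp G g h) = src G g"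
    and tgt_comp:
      "\<lbrakk>g \<in> arrows G; h \<in> arrows G; tgt G g = src G h\<rbrakk> \<Longrightarrow> tgt G (comp G g h) = tgt G h"
    and comp_assoc:
      "\<lbrakk>g \<in> arrows G; h \<in> arrows G; k \<in> arrows G; tgt G g = src G h; tgt G h = src G k\<rbrakk>
        \<Longrightarrow> comp G (comp G g h) k = comp G g (comp G h k)"
    and ident_closed: "ident G \<in> base G \<rightarrow> arrows G"
    and src_ident: "m \<in> base G \<Longrightarrow> src G (ident G m) = m"
    and tgt_ident: "m \<in> base G \<Longrightarrow> tgt G (ident G m) = m"
    and ident_comp: "g \<in> arrows G \<Longrightarrow> comp G (ident G (src G g)) g = g"
    and comp_ident: "g \<in> arrows G \<Longrightarrow> comp G g (ident G (tgt G g)) = g"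
    and inverse_exists:
      "g \<in> arrows G \<Longrightarrow>
        \<exists>h\<in>arrows G. src G h = tgt G g \<and> tgt G h = src G g \<and>
          comp G g h = ident G (src G g) \<and> comp G h g = ident G (tgt G g)"

definition fibre_product ::
  "('m, 'a, 'z) grpd_scheme \<Rightarrow> ('m, 'b, 'w) grpd_scheme \<Rightarrow> ('a \<times> 'b) set" where
  "fibre_product G H = {(g, d). g \<in> arrows G \<and> d \<in> arrows H \<and> tgt G g = src H d}"

locale grpd_pair =
  fixes G :: "('m, 'a, 'z) grpd_scheme"
    and H :: "('m, 'b, 'w) grpd_scheme"
    and \<sigma> :: "'a \<times> 'b \<Rightarrow> 'b \<times> 'a"
begin

abbreviation compG (infixl \<open>\<star>\<^sub>G\<close> 70) where
  "g1 \<star>\<^sub>G g2 \<equiv> comp G g1 g2"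

abbreviation compH (infixl \<open>\<star>\<^sub>H\<close> 70) where
  "d1 \<star>\<^sub>H d2 \<equiv> comp H d1 d2"

abbreviation lact (\<open>(_ \<rightharpoonup> _)\<close> [71, 71] 70) where
  "g \<rightharpoonup> d \<equiv> fst (\<sigma> (g, d))"

abbreviation ract (\<open>(_ \<leftharpoonup> _)\<close> [71, 71] 70) where
  "g \<leftharpoonup> d \<equiv> snd (\<sigma> (g, d))"

end

locale matched_pair_groupoids =
  grpd_pair G H \<sigma> + G: groupoid G + H: groupoid H
  for G :: "('m, 'a, 'z) grpd_scheme"
    and H :: "('m, 'b, 'w) grpd_scheme"
    and \<sigma> :: "'a \<times> 'b \<Rightarrow> 'b \<times> 'a" +
  assumes same_base: "base G = base H"
    and sigma_closed: "\<sigma> \<in> fibre_product G H \<rightarrow> fibre_product H G"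
    and src_lact: "(g, d) \<in> fibre_product G H \<Longrightarrow> src H (g \<rightharpoonup> d) = src G g"
    and tgt_ract: "(g, d) \<in> fibre_product G H \<Longrightarrow> tgt G (g \<leftharpoonup> d) = tgt H d"
    and ident_lact: "d \<in> arrows H \<Longrightarrow> ident G (src H d) \<rightharpoonup> d = d"
    and lact_lact:
      "\<lbrakk>(g1, g2) \<in> fibre_product G G; (g2, d) \<in> fibre_product G H\<rbrakk>
        \<Longrightarrow> g1 \<rightharpoonup> (g2 \<rightharpoonup> d) = (g1 \<star>\<^sub>G g2) \<rightharpoonup> d"
    and comp_ract:
      "\<lbrakk>(g1, g2) \<in> fibre_product G G; (g2, d) \<in> fibre_product G H\<rbrakk>
        \<Longrightarrow> (g1 \<star>\<^sub>G g2) \<leftharpoonup> d = (g1 \<leftharpoonup> (g2 \<rightharpoonup> d)) \<star>\<^sub>G (g2 \<leftharpoonup> d)"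
    and ract_ident: "g \<in> arrows G \<Longrightarrow> g \<leftharpoonup> ident H (tgt G g) = g"
    and ract_ract:
      "\<lbrakk>(g, d1) \<in> fibre_product G H; (d1, d2) \<in> fibre_product H H\<rbrakk>
        \<Longrightarrow> (g \<leftharpoonup> d1) \<leftharpoonup> d2 = g \<leftharpoonup> (d1 \<star>\<^sub>H d2)"
    and lact_comp:
      "\<lbrakk>(g, d1) \<in> fibre_product G H; (d1, d2) \<in> fibre_product H H\<rbrakk>
        \<Longrightarrow> g \<rightharpoonup> (d1 \<star>\<^sub>H d2) = (g \<rightharpoonup> d1) \<star>\<^sub>H ((g \<leftharpoonup> d1) \<rightharpoonup> d2)"

locale braided_groupoid = matched_pair_groupoids G G \<sigma>
  for G :: "('m, 'a, 'z) grpd_scheme"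
    and \<sigma> :: "'a \<times> 'a \<Rightarrow> 'a \<times> 'a" +
  assumes braided_commutative:
    "(g, d) \<in> fibre_product G G \<Longrightarrow> (g \<rightharpoonup> d) \<star>\<^sub>G (g \<leftharpoonup> d) = g \<star>\<^sub>G d"

text \<open>
  In the product below and in \<open>sigma_hat\<close> the first component of the second arrow is ignored: on
  composable pairs it is \<open>act G (l, a)\<close>.
\<close>

definition Q_groupoid :: "('l, 'g, 'z) dyn_group_scheme \<Rightarrow> ('l, 'l \<times> 'g) grpd" where
  "Q_groupoid G =
     \<lparr>base = params G, arrows = params G \<times> elems G,
      src = fst, tgt = act G,
      comp = (\<lambda>(l, a) (_, b). (l, op G l a b)),
      ident = (\<lambda>l. (l, neutral G))\<rparr>"

definition sigma_hat ::
  "('l, 'g, 'z) dyn_group_scheme \<Rightarrow> ('l \<times> 'g \<times> 'g \<Rightarrow> 'g \<times> 'g)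
    \<Rightarrow> ('l \<times> 'g) \<times> ('l \<times> 'g) \<Rightarrow> ('l \<times> 'g) \<times> ('l \<times> 'g)" where
  "sigma_hat G \<sigma> =
     (\<lambda>((l, a), (_, b)).
        let (u, v) = \<sigma> (l, a, b) in ((l, u), (act G (l, u), v)))"

end

theory Submission
  imports Defs
begin

text \<open>On arrows \<open>(l, a)\<close> each groupoid law splits into an equation in
  \<open>elems G\<close>, which is a dynamical axiom, and one between base points. Only the base
  point of the right unit law needs more: \<open>lact_neutral\<close>, a consequence of braided
  commutativity and cancellation.\<close>

lemma Q_groupoid_simps [simp]:
  "base (Q_groupoid G) = params G"
  "arrows (Q_groupoid G) = params G \<times> elems G"
  "src (Q_groupoid G) = fst"
  "tgt (Q_groupoid G) = act G"
  "comp (Q_groupoid G) (l, a) (l', b) = (l, op G l a b)"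
  "ident (Q_groupoid G) l = (l, neutral G)"
  by (simp_all add: Q_groupoid_def)

lemma sigma_hat_simp [simp]:
  "sigma_hat G \<sigma> ((l, a), (l', b)) =
    ((l, fst (\<sigma> (l, a, b))), (act G (l, fst (\<sigma> (l, a, b))), snd (\<sigma> (l, a, b))))"
  by (simp add: sigma_hat_def split_beta)

lemma mem_fibre_product_Q [simp]:
  "((l, a), (l', b)) \<in> fibre_product (Q_groupoid G) (Q_groupoid H) \<longleftrightarrow>
    l \<in> params G \<and> a \<in> elems G \<and> l' \<in> params H \<and> b \<in> elems H \<and> l' = act G (l, a)"
  by (auto simp: fibre_product_def)

context dynamical_group
begin

lemma act_in_params: "\<lbrakk>l \<in> params G; a \<in> elems G\<rbrakk> \<Longrightarrow> act G (l, a) \<in> params G"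
  using act_closed by blast

lemma left_cancel:
  assumes l: "l \<in> params G" and a: "a \<in> elems G" and b: "b \<in> elems G" and c: "c \<in> elems G"
    and eq: "op G l a b = op G l a c"
  shows "b = c"
proof -
  let ?m = "act G (l, a)"
  note m = act_in_params[OF l a]
  obtain d where d: "d \<in> elems G" "op G l a d = neutral G" "op G ?m d a = neutral G"
    using inverse_exists[OF l a] by blast
  \<comment> \<open>The inverse leads back to \<open>l\<close>, so in associativity at
    \<open>?m\<close> the inner product is the one over \<open>l\<close>.\<close>
  have md: "act G (?m, d) = l"
    using act_op[OF l a d(1)] d(2) act_neutral[OF l] by simp
  have "op G ?m d (op G l a x) = x" if "x \<in> elems G" for x
    using op_assoc[OF m d(1) a that] d(3) neutral_op[OF m that] by (simp add: md)
  then show ?thesis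
    using b c eq by metis
qed

lemma groupoid_Q: "groupoid (Q_groupoid G)"
proof
  fix g
  assume "g \<in> arrows (Q_groupoid G)"
  then obtain l a where g: "g = (l, a)" and l: "l \<in> params G" and a: "a \<in> elems G"
    by auto
  obtain b where b: "b \<in> elems G" "op G l a b = neutral G"
    "op G (act G (l, a)) b a = neutral G"
    using inverse_exists[OF l a] by blast
  have "act G (act G (l, a), b) = l"
    using act_op[OF l a b(1)] b(2) act_neutral[OF l] by simp
  then show "\<exists>h\<in>arrows (Q_groupoid G).
      src (Q_groupoid G) h = tgt (Q_groupoid G) g \<and> tgt (Q_groupoid G) h = src (Q_groupoid G) g \<and>
      comp (Q_groupoid G) g h = ident (Q_groupoid G) (src (Q_groupoid G) g) \<and>
      comp (Q_groupoid G) h g = ident (Q_groupoid G) (tgt (Q_groupoid G) g)"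
    using l a b by (intro bexI[of _ "(act G (l, a), b)"]) (auto simp: g act_in_params)
qed (auto simp: act_in_params op_closed act_op op_assoc neutral_closed act_neutral
      op_neutral neutral_op)

end

context braided_dynamical_group
begin

lemma \<sigma>_closed:
  assumes "l \<in> params G" "a \<in> elems G" "b \<in> elems G"
  shows "a \<rightharpoonup>\<^bsub>l\<^esub> b \<in> elems G" "a \<leftharpoonup>\<^bsub>l\<^esub> b \<in> elems G"
  using morphism assms by (auto simp: dyn_morphism_def dyn_tensor_def Pi_iff mem_Times_iff)

lemma act_\<sigma>:
  assumes "l \<in> params G" "a \<in> elems G" "b \<in> elems G"
  shows "act G (act G (l, a \<rightharpoonup>\<^bsub>l\<^esub> b), a \<leftharpoonup>\<^bsub>l\<^esub> b) = act G (act G (l, a), b)"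
  using morphism assms by (auto simp: dyn_morphism_def dyn_tensor_def split_beta)

text \<open>
  The unit law \<open>a \<leftharpoonup>\<^bsub>l\<^esub> neutral G = a\<close> fixes only the second component of the arrow
  \<open>(l, a) \<leftharpoonup> (act G (l, a), neutral G)\<close>; the first component is \<open>act G (l, u)\<close> with
  \<open>u = a \<rightharpoonup>\<^bsub>l\<^esub> neutral G\<close>, so \<open>u = neutral G\<close> has to be derived. Cancelling \<open>u\<close> in the
  law for \<open>a \<rightharpoonup>\<^bsub>l\<^esub> (neutral G \<cdot> neutral G)\<close> shows that \<open>(act G (l, u), a)\<close> fixes
  \<open>neutral G\<close>. Hence acting on it with \<open>(l, u) \<star> (act G (l, u), a) = (l, a)\<close> gives
  \<open>u \<rightharpoonup>\<^bsub>l\<^esub> neutral G = u\<close>. Braided commutativity for \<open>u\<close> then reads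
  \<open>u \<circ>\<^bsub>l\<^esub> u = u\<close>, so \<open>u\<close> cancels.
\<close>

lemma lact_neutral:
  assumes l: "l \<in> params G" and a: "a \<in> elems G"
  shows "a \<rightharpoonup>\<^bsub>l\<^esub> neutral G = neutral G"
proof -
  note e = G.neutral_closed
  define u where "u = a \<rightharpoonup>\<^bsub>l\<^esub> neutral G"
  have u: "u \<in> elems G"
    unfolding u_def by (rule \<sigma>_closed[OF l a e])
  have lu: "act G (l, u) \<in> params G"
    using l u by (rule G.act_in_params)
  have ua: "op G l u a = a"
    using braided_commutative[OF l a e] ract_neutral[OF l a] G.op_neutral[OF l a]
    by (simp add: u_def)
  have "a \<rightharpoonup>\<^bsub>act G (l, u)\<^esub> neutral G = neutral G"
  proof -
    have "op G l u (a \<rightharpoonup>\<^bsub>act G (l, u)\<^esub> neutral G) = u"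
      using lact_op[OF l a e e] ract_neutral[OF l a] G.op_neutral[OF G.act_in_params[OF l a] e]
      by (simp add: u_def)
    then show ?thesis
      using G.left_cancel[OF l u \<sigma>_closed(1)[OF lu a e] e] G.op_neutral[OF l u] by simp
  qed
  then have "u \<rightharpoonup>\<^bsub>l\<^esub> neutral G = u"
    using op_lact[OF l u a e] ua by (simp add: u_def)
  then have "op G l u u = op G l u (neutral G)"
    using braided_commutative[OF l u e] ract_neutral[OF l u] by simp
  then show ?thesis
    using G.left_cancel[OF l u u e] by (simp add: u_def)
qed

lemma braided_groupoid_Q: "braided_groupoid (Q_groupoid G) (sigma_hat G \<sigma>)"
proof -
  interpret Q: groupoid "Q_groupoid G"
    by (rule G.groupoid_Q)
  show ?thesis
    \<comment> \<open>Base points agree in \<open>ract_ract\<close> by \<open>lact_op\<close> and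
      \<open>act_op\<close>, in \<open>comp_ract\<close> by \<open>op_lact\<close>;
      \<open>act_\<sigma>\<close> gives the targets.\<close>
    by unfold_locales
      (auto simp: \<sigma>_closed act_\<sigma> G.act_in_params neutral_lact op_lact lact_op ract_neutral
        ract_op op_ract lact_neutral G.act_neutral G.act_op braided_commutative)
qed

end

theorem theorem2p34:
  fixes G :: "('l, 'g) dyn_group"
    and \<sigma> :: "'l \<times> 'g \<times> 'g \<Rightarrow> 'g \<times> 'g"
  assumes "braided_dynamical_group G \<sigma>"
  shows "braided_groupoid (Q_groupoid G) (sigma_hat G \<sigma>)"
  using assms by (rule braided_dynamical_group.braided_groupoid_Q)

end
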